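(* Let $\mathbf r=(\psi,\psi\cos\theta,\psi\sin\theta)$ be a space-periodic soliton on $LC^*$ of the flow $\frac{\partial\mathbf r}{\partial t}=(k_g)_s\mathbf r-k_g\mathbf T$, with integration constants $\lambda,\mu$. If the soliton rotates around the light-like axis $(1,1,0)$, then $\mu=0$ and $\psi$ is given by $$(1-\cos\theta)\,\psi=-b\,k_g,$$ where $b$ denotes an arbitrary positive constant (i.e. the relation holds along $\mathbf r$ for some constant $b>0$, whose value is not determined).
   Context: $\mathbb E^3_1$ is $\mathbb R^3$ with coordinates $(x,y,z)$ and $\langle \mathbf u,\mathbf v\rangle_L=-u_1v_1+u_2v_2+u_3v_3$; $LC^*=\{(\psi,\psi\cos\theta,\psi\sin\theta):\psi>0\}$. For a smooth curve $\mathbf r$ on $LC^*$ with space-like velocity, $s$ is arc length, $\mathbf T=\mathbf r_s$, $\mathbf Y$ is the unique light-like field along $\mathbf r$ with $\langle \mathbf Y,\mathbf T\rangle_L=0$, $\langle\mathbf r,\mathbf Y\rangle_L=1$, and $k_g=\langle\mathbf r_{ss},\mathbf Y\rangle_L$. Curves are oriented so that $d\theta/ds=1/\psi$. A soliton of the flow is a curve moving by isometries under it; equivalently $(k_g)_{sss}-3k_g(k_g)_s=0$, which integrates to $$(k_g)_{ss}-\tfrac32k_g^2+\tfrac\lambda2=0,\qquad ((k_g)_s)^2-k_g^3+\lambda k_g+\mu=0$$ with integration constants $\lambda,\mu$. A space-periodic soliton is one for which $k_g(s)$, $s\in\mathbb R$, is non-constant and periodic; then $\lambda>3(\mu/2)^{2/3}$,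 the cubic $x^3-\lambda x-\mu$ has three distinct real roots $x_1<x_2<x_3$, and $k_g$ oscillates between $x_1$ and $x_2$. The soliton "rotates around the light-like axis $(1,1,0)$" if the isometries moving it are the rotations about that axis, i.e. along $\mathbf r$ the field $\mathbf J=(k_g)_s\mathbf r-k_g\mathbf T$ is a non-zero constant multiple of the Killing field $\psi\sin\theta\,\partial_\psi-(1-\cos\theta)\,\partial_\theta$ (generator $z\partial_x+z\partial_y+(x-y)\partial_z$). *)

theory Defs
  imports "HOL-Analysis.Analysis"
begin

definition lorentz :: "real ^ 3 \<Rightarrow> real ^ 3 \<Rightarrow> real" where
  "lorentz u v = - (u $ 1) * (v $ 1) + (u $ 2) * (v $ 2) + (u $ 3) * (v $ 3)"

definition lightlike :: "real ^ 3 \<Rightarrow> bool" where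
  "lightlike v \<longleftrightarrow> v \<noteq> 0 \<and> lorentz v v = 0"

definition light_cone :: "(real ^ 3) set" where
  "light_cone = {vector [p, p * cos t, p * sin t] | p t. p > 0}"

definition smooth :: "(real \<Rightarrow> real) \<Rightarrow> bool" where
  "smooth f \<longleftrightarrow> (\<forall>n s. (deriv ^^ n) f differentiable at s)"


section \<open>Curves on the light cone\<close>

text \<open>All curves are defined on the whole line and are parametrised by arc length.\<close>

definition cone_curve :: "(real \<Rightarrow> real) \<Rightarrow> (real \<Rightarrow> real) \<Rightarrow> real \<Rightarrow> real ^ 3" where
  "cone_curve \<psi> \<theta> s = vector [\<psi> s, \<psi> s * cos (\<theta> s), \<psi> s * sin (\<theta> s)]"

definition tangent :: "(real \<Rightarrow> real ^ 3) \<Rightarrow> real \<Rightarrow> real ^ 3" where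
  "tangent r s = vector_derivative r (at s)"

definition arclength_cone_curve :: "(real \<Rightarrow> real) \<Rightarrow> (real \<Rightarrow> real) \<Rightarrow> bool" where
  "arclength_cone_curve \<psi> \<theta> \<longleftrightarrow>
     smooth \<psi> \<and> smooth \<theta> \<and> (\<forall>s. \<psi> s > 0) \<and>
     (\<forall>s. lorentz (tangent (cone_curve \<psi> \<theta>) s) (tangent (cone_curve \<psi> \<theta>) s) = 1) \<and>
     (\<forall>s. deriv \<theta> s = 1 / \<psi> s)"

text \<open>Existence and uniqueness of the transversal light-like field
  are shown in \<open>transversal_ex1\<close> below.\<close>

definition is_transversal :: "(real \<Rightarrow> real ^ 3) \<Rightarrow> real \<Rightarrow> real ^ 3 \<Rightarrow> bool" where
  "is_transversal r s Y \<longleftrightarrow>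
     lightlike Y \<and> lorentz Y (tangent r s) = 0 \<and> lorentz (r s) Y = 1"

definition transversal :: "(real \<Rightarrow> real ^ 3) \<Rightarrow> real \<Rightarrow> real ^ 3" where
  "transversal r s = (THE Y. is_transversal r s Y)"

definition k_g :: "(real \<Rightarrow> real ^ 3) \<Rightarrow> real \<Rightarrow> real" where
  "k_g r s = lorentz (vector_derivative (tangent r) (at s)) (transversal r s)"


section \<open>The flow and its solitons\<close>

definition flow_field :: "(real \<Rightarrow> real ^ 3) \<Rightarrow> real \<Rightarrow> real ^ 3" where
  "flow_field r s = deriv (k_g r) s *\<^sub>R r s - k_g r s *\<^sub>R tangent r s"

text \<open>An isometry of Minkowski space that maps the half-cone to itself fixes its apex,
  hence is linear.\<close>

definition cone_isometry :: "(real ^ 3 \<Rightarrow> real ^ 3) \<Rightarrow> bool" where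
  "cone_isometry A \<longleftrightarrow>
     linear A \<and> (\<forall>u v. lorentz (A u) (A v) = lorentz u v) \<and> A ` light_cone \<subseteq> light_cone"

text \<open>The curves \<open>A t \<circ> r\<close> (which are again parametrised by arc length) solve the flow,
  with initial curve \<open>r\<close>.\<close>

definition moved_by :: "(real \<Rightarrow> real ^ 3 \<Rightarrow> real ^ 3) \<Rightarrow> (real \<Rightarrow> real ^ 3) \<Rightarrow> bool" where
  "moved_by A r \<longleftrightarrow>
     A 0 = id \<and> (\<forall>t. cone_isometry (A t)) \<and>
     (\<forall>t s. ((\<lambda>t'. A t' (r s)) has_vector_derivative flow_field (A t \<circ> r) s) (at t))"

definition soliton :: "(real \<Rightarrow> real ^ 3) \<Rightarrow> bool" where
  "soliton r \<longleftrightarrow> (\<exists>A. moved_by A r)"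

definition space_periodic_soliton :: "(real \<Rightarrow> real ^ 3) \<Rightarrow> bool" where
  "space_periodic_soliton r \<longleftrightarrow>
     soliton r \<and> \<not> (k_g r) constant_on UNIV \<and> (\<exists>p>0. \<forall>s. k_g r (s + p) = k_g r s)"

definition integration_constants :: "(real \<Rightarrow> real ^ 3) \<Rightarrow> real \<Rightarrow> real \<Rightarrow> bool" where
  "integration_constants r lam mu \<longleftrightarrow>
     (\<forall>s. deriv (deriv (k_g r)) s - 3 / 2 * (k_g r s)\<^sup>2 + lam / 2 = 0) \<and>
     (\<forall>s. (deriv (k_g r) s)\<^sup>2 - (k_g r s) ^ 3 + lam * k_g r s + mu = 0)"

text \<open>The Killing field \<open>z \<partial>\<^sub>x + z \<partial>\<^sub>y + (x - y) \<partial>\<^sub>z\<close>, whose flow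
  consists of the rotations about \<open>(1,1,0)\<close>; see \<open>killing110_polar\<close> for its polar form
  \<open>\<psi> sin \<theta> \<partial>\<^sub>\<psi> - (1 - cos \<theta>) \<partial>\<^sub>\<theta>\<close>.\<close>

definition killing110 :: "real ^ 3 \<Rightarrow> real ^ 3" where
  "killing110 v = vector [v $ 3, v $ 3, v $ 1 - v $ 2]"

text \<open>By \<open>rotates_around_110_iff\<close>, this says that the rotations
  about \<open>(1,1,0)\<close> move the curve along the flow.\<close>

definition rotates_around_110 :: "(real \<Rightarrow> real ^ 3) \<Rightarrow> bool" where
  "rotates_around_110 r \<longleftrightarrow> (\<exists>c. c \<noteq> 0 \<and> (\<forall>s. flow_field r s = c *\<^sub>R killing110 (r s)))"


section \<open>Consistency of the definitions\<close>

lemmas vec3 = vec_eq_iff forall_3 vector_3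

lemma killing110_polar:
  "killing110 (vector [p, p * cos t, p * sin t]) =
     (p * sin t) *\<^sub>R vector [1, cos t, sin t]
     - (1 - cos t) *\<^sub>R vector [0, - p * sin t, p * cos t]"
proof -
  have e: "sin t * sin t = 1 - cos t * cos t"
    using sin_cos_squared_add[of t] by (simp add: power2_eq_square algebra_simps)
  have "p * (1 - cos t) = p * (sin t * sin t) - (1 - cos t) * p * cos t"
    unfolding e by algebra
  then show ?thesis by (simp add: killing110_def vec3 algebra_simps)
qed

lemma smooth_DERIV: "smooth f \<Longrightarrow> (f has_real_derivative deriv f s) (at s)"
  unfolding smooth_def
  by (metis DERIV_deriv_iff_real_differentiable funpow_0)

lemma has_vector_derivative_vec:
  fixes f :: "real \<Rightarrow> real ^ 'n"
  assumes "\<And>i. ((\<lambda>s. f s $ i) has_vector_derivative D $ i) (at s)"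
  shows "(f has_vector_derivative D) (at s)"
  using assms unfolding has_vector_derivative_def
  by (subst has_derivative_componentwise_within) (auto simp: Basis_vec_def inner_axis)

lemma tangent_cone_curve:
  assumes "arclength_cone_curve \<psi> \<theta>"
  shows "(cone_curve \<psi> \<theta> has_vector_derivative
      vector [deriv \<psi> s, deriv \<psi> s * cos (\<theta> s) - sin (\<theta> s), deriv \<psi> s * sin (\<theta> s) + cos (\<theta> s)]) (at s)"
    (is "(_ has_vector_derivative ?T) _")
proof -
  have p: "\<psi> s > 0" and d: "(\<psi> has_real_derivative deriv \<psi> s) (at s)"
    "(\<theta> has_real_derivative 1 / \<psi> s) (at s)"
    using assms smooth_DERIV unfolding arclength_cone_curve_def by metis+
  have "((\<lambda>s. cone_curve \<psi> \<theta> s $ i) has_vector_derivative ?T $ i) (at s)" for i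
    using exhaust_3[of i] p
    by (auto simp: cone_curve_def has_real_derivative_iff_has_vector_derivative[symmetric]
        intro!: derivative_eq_intros d)
  then show ?thesis
    by (rule has_vector_derivative_vec)
qed

lemma transversal_ex1:
  assumes "arclength_cone_curve \<psi> \<theta>"
  shows "\<exists>!Y. is_transversal (cone_curve \<psi> \<theta>) s Y"
proof -
  define p q c z where "p = \<psi> s" and "q = deriv \<psi> s" and "c = cos (\<theta> s)" and "z = sin (\<theta> s)"
  have p: "p > 0" using assms by (simp add: arclength_cone_curve_def p_def)
  have cz: "c\<^sup>2 + z\<^sup>2 = 1" by (simp add: c_def z_def)
  define Y0 where "Y0 = - (1 / (2 * p)) *\<^sub>R (vector
    [q\<^sup>2 + 1, (q\<^sup>2 - 1) * c - 2 * q * z, (q\<^sup>2 - 1) * z + 2 * q * c] :: real ^ 3)"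
  have eq: "is_transversal (cone_curve \<psi> \<theta>) s Y \<longleftrightarrow> Y \<noteq> 0 \<and>
     - Y$1 * Y$1 + Y$2 * Y$2 + Y$3 * Y$3 = 0 \<and>
     - Y$1 * q + Y$2 * (q * c - z) + Y$3 * (q * z + c) = 0 \<and>
     - p * Y$1 + p * c * Y$2 + p * z * Y$3 = 1" for Y
    unfolding is_transversal_def lightlike_def tangent_def
      vector_derivative_at[OF tangent_cone_curve[OF assms]]
    by (simp add: lorentz_def cone_curve_def p_def q_def c_def z_def)
  show ?thesis
  proof
    have "2 * p * Y0$1 = - (q\<^sup>2 + 1)" "2 * p * Y0$2 = - ((q\<^sup>2 - 1) * c - 2 * q * z)"
      "2 * p * Y0$3 = - ((q\<^sup>2 - 1) * z + 2 * q * c)"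
      using p by (simp_all add: Y0_def field_simps)
    note y = this
    have "Y0 \<noteq> 0"
    proof
      assume "Y0 = 0"
      then have "q\<^sup>2 + 1 = 0" using y(1) by simp
      then show False by (smt (verit) zero_le_power2)
    qed
    moreover have "(2*p)^2 * (- Y0$1 * Y0$1 + Y0$2 * Y0$2 + Y0$3 * Y0$3) = 0"
      using y cz by algebra
    moreover have "(2*p) * (- Y0$1 * q + Y0$2 * (q * c - z) + Y0$3 * (q * z + c)) = 0"
      using y cz by algebra
    moreover have "2 * (- p * Y0$1 + p * c * Y0$2 + p * z * Y0$3) = 2"
      using y cz by algebra
    ultimately show "is_transversal (cone_curve \<psi> \<theta>) s Y0" unfolding eq using p by simp
  next
    fix Y assume "is_transversal (cone_curve \<psi> \<theta>) s Y"
    then have h: "- Y$1 * Y$1 + Y$2 * Y$2 + Y$3 * Y$3 = 0"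
     "- Y$1 * q + Y$2 * (q * c - z) + Y$3 * (q * z + c) = 0"
     "- p * Y$1 + p * c * Y$2 + p * z * Y$3 = 1" unfolding eq by auto
    define a b where "a = c * Y$2 + z * Y$3" and "b = c * Y$3 - z * Y$2"
    have ab: "Y$2 = c * a - z * b" "Y$3 = z * a + c * b"
      unfolding a_def b_def using cz by algebra+
    have 1: "p * (a - Y$1) = 1" using h(3) unfolding a_def by algebra
    have 2: "p * b = - q" using h(2) 1 unfolding a_def b_def by algebra
    have 3: "a\<^sup>2 + b\<^sup>2 = (Y$1)\<^sup>2" using h(1) ab cz by algebra
    have 4: "p * (a + Y$1) = - q\<^sup>2" using 1 2 3 by algebra
    have "2 * p * Y$1 = - (q\<^sup>2 + 1)" "2 * p * Y$2 = - ((q\<^sup>2 - 1) * c - 2 * q * z)"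
      "2 * p * Y$3 = - ((q\<^sup>2 - 1) * z + 2 * q * c)"
      using ab 1 2 4 by algebra+
    then show "Y = Y0" using p by (simp add: Y0_def vec3 field_simps)
  qed
qed

definition rotation110 :: "real \<Rightarrow> real ^ 3 \<Rightarrow> real ^ 3" where
  "rotation110 u v = v + u *\<^sub>R killing110 v + (u\<^sup>2 / 2) *\<^sub>R killing110 (killing110 v)"

lemma linear_killing110: "linear killing110"
  by (rule linearI) (simp_all add: killing110_def vec3 algebra_simps)

lemma linear_rotation110: "linear (rotation110 u)"
  by (rule linearI)
    (simp_all add: rotation110_def linear_add[OF linear_killing110]
      linear_cmul[OF linear_killing110] algebra_simps)

lemma lorentz_rotation110: "lorentz (rotation110 u v) (rotation110 u w) = lorentz v w"
proof -
  define h where "h = u\<^sup>2 / 2"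
  have h: "u\<^sup>2 = 2 * h" by (simp add: h_def)
  have c: "rotation110 u v $ 1 = v$1 + u * v$3 + h * (v$1 - v$2)"
    "rotation110 u v $ 2 = v$2 + u * v$3 + h * (v$1 - v$2)"
    "rotation110 u v $ 3 = v$3 + u * (v$1 - v$2)" for v
    by (simp_all add: rotation110_def killing110_def h_def)
  show ?thesis unfolding lorentz_def c using h by algebra
qed

lemma rotation110_inverse: "rotation110 (- u) (rotation110 u v) = v"
  by (simp add: rotation110_def killing110_def vec3 algebra_simps power2_eq_square)

lemma rotation110_axis: "rotation110 u (vector [1, 1, 0]) = vector [1, 1, 0]"
  by (simp add: rotation110_def killing110_def vec3)

lemma light_cone_iff: "v \<in> light_cone \<longleftrightarrow> v $ 1 > 0 \<and> lorentz v v = 0"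
proof
  assume "v \<in> light_cone"
  then obtain p t where "p > 0" and v: "v = vector [p, p * cos t, p * sin t]"
    by (auto simp: light_cone_def)
  moreover have "(p * cos t)\<^sup>2 + (p * sin t)\<^sup>2 = p\<^sup>2"
    using sin_cos_squared_add[of t] by algebra
  ultimately show "v $ 1 > 0 \<and> lorentz v v = 0"
    by (simp add: lorentz_def power2_eq_square)
next
  assume h: "v $ 1 > 0 \<and> lorentz v v = 0"
  then have "(v$2 / v$1)\<^sup>2 + (v$3 / v$1)\<^sup>2 = 1"
    by (simp add: lorentz_def power2_eq_square divide_simps)
  then obtain t where "v$2 / v$1 = cos t" "v$3 / v$1 = sin t"
    using sincos_total_2pi by metis
  then have "v = vector [v$1, v$1 * cos t, v$1 * sin t]"
    using h by (simp add: vec3 field_simps)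
  then show "v \<in> light_cone" using h unfolding light_cone_def by blast
qed

lemma cone_isometry_rotation110: "cone_isometry (rotation110 u)"
proof -
  have "rotation110 u v \<in> light_cone" if "v \<in> light_cone" for v
  proof -
    have v: "v$1 > 0" "lorentz v v = 0" using that by (auto simp: light_cone_iff)
    have e: "(v$1 - v$2) * (v$1 + v$2) = (v$3)\<^sup>2" using v(2) unfolding lorentz_def by algebra
    have "v$1 - v$2 \<ge> 0"
    proof (rule ccontr)
      assume n: "\<not> v$1 - v$2 \<ge> 0"
      with v have "v$1 + v$2 > 0" by simp
      with n have "(v$1 - v$2) * (v$1 + v$2) < 0" by (simp add: mult_neg_pos)
      with e show False by (smt (verit) zero_le_power2)
    qed
    have "2 * (v$1 - v$2) * (v$1 + u * v$3 + u\<^sup>2 / 2 * (v$1 - v$2))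
        = (v$1 - v$2)\<^sup>2 + (v$3 + u * (v$1 - v$2))\<^sup>2"
    proof -
      define h where "h = u\<^sup>2 / 2"
      have "u\<^sup>2 = 2 * h" by (simp add: h_def)
      then show ?thesis using e unfolding h_def[symmetric] by algebra
    qed
    note sq = this
    have "v$1 + u * v$3 + u\<^sup>2 / 2 * (v$1 - v$2) > 0"
    proof (cases "v$1 - v$2 = 0")
      case True
      then have "v$3 = 0" using e by simp
      with True v(1) show ?thesis by simp
    next
      case False
      then have w: "2 * (v$1 - v$2) > 0" using \<open>v$1 - v$2 \<ge> 0\<close> by simp
      have "(v$1 - v$2)\<^sup>2 + (v$3 + u * (v$1 - v$2))\<^sup>2 > 0"
        using False by (intro add_pos_nonneg) auto
      then show ?thesis using w sq by (metis zero_less_mult_pos)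
    qed
    then have "rotation110 u v $ 1 > 0"
      by (simp add: rotation110_def killing110_def)
    then show ?thesis using v by (simp add: light_cone_iff lorentz_rotation110)
  qed
  then show ?thesis
    unfolding cone_isometry_def using linear_rotation110 lorentz_rotation110 by auto
qed

lemma vector_derivative_linear:
  fixes A :: "real ^ 3 \<Rightarrow> real ^ 3"
  assumes "linear A" "(f has_vector_derivative f') (at s)"
  shows "((\<lambda>s. A (f s)) has_vector_derivative A f') (at s)"
  using assms bounded_linear.has_vector_derivative linear_conv_bounded_linear by blast

lemma tangent_twice:
  assumes "arclength_cone_curve \<psi> \<theta>"
  shows "(tangent (cone_curve \<psi> \<theta>) has_vector_derivative
            vector_derivative (tangent (cone_curve \<psi> \<theta>)) (at s)) (at s)"
proof -
  have d: "(\<psi> has_real_derivative deriv \<psi> s) (at s)" "(\<theta> has_real_derivative deriv \<theta> s) (at s)"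
    using assms smooth_DERIV unfolding arclength_cone_curve_def by metis+
  have "(deriv ^^ 1) \<psi> differentiable at s"
    using assms unfolding arclength_cone_curve_def smooth_def by blast
  then have d2: "(deriv \<psi> has_real_derivative deriv (deriv \<psi>) s) (at s)"
    by (simp add: DERIV_deriv_iff_real_differentiable)
  define D where "D = (vector [deriv (deriv \<psi>) s,
     deriv (deriv \<psi>) s * cos (\<theta> s) - deriv \<psi> s * (sin (\<theta> s) * deriv \<theta> s) - cos (\<theta> s) * deriv \<theta> s,
     deriv (deriv \<psi>) s * sin (\<theta> s) + deriv \<psi> s * (cos (\<theta> s) * deriv \<theta> s) - sin (\<theta> s) * deriv \<theta> s] :: real ^ 3)"
  have T: "tangent (cone_curve \<psi> \<theta>) = (\<lambda>s. vector [deriv \<psi> s,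
     deriv \<psi> s * cos (\<theta> s) - sin (\<theta> s), deriv \<psi> s * sin (\<theta> s) + cos (\<theta> s)])"
    unfolding tangent_def using vector_derivative_at[OF tangent_cone_curve[OF assms]] by auto
  have "((\<lambda>s. tangent (cone_curve \<psi> \<theta>) s $ i) has_vector_derivative D $ i) (at s)" for i
    using exhaust_3[of i]
    by (auto simp: T D_def has_real_derivative_iff_has_vector_derivative[symmetric]
        intro!: derivative_eq_intros d d2)
  then have "(tangent (cone_curve \<psi> \<theta>) has_vector_derivative D) (at s)"
    by (rule has_vector_derivative_vec)
  then show ?thesis using vector_derivative_at by metis
qed

lemma flow_field_rotation110:
  assumes "arclength_cone_curve \<psi> \<theta>"
  defines "r \<equiv> cone_curve \<psi> \<theta>"
  shows "flow_field (rotation110 u \<circ> r) s = rotation110 u (flow_field r s)"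
proof -
  let ?A = "rotation110 u"
  have T: "tangent (?A \<circ> r) = ?A \<circ> tangent r"
    using vector_derivative_linear[OF linear_rotation110 tangent_cone_curve[OF assms(1)]]
      vector_derivative_at tangent_cone_curve[OF assms(1)]
    unfolding r_def tangent_def comp_def by (metis (no_types, lifting))
  have N: "vector_derivative (tangent (?A \<circ> r)) (at s) = ?A (vector_derivative (tangent r) (at s))" for s
    unfolding T
    using vector_derivative_at[OF vector_derivative_linear[OF linear_rotation110
          tangent_twice[OF assms(1)]]]
    by (simp add: r_def comp_def)
  have A0: "rotation110 w 0 = 0" for w using linear_0 linear_rotation110 by blast
  have eq: "is_transversal (?A \<circ> r) s (?A Y) \<longleftrightarrow> is_transversal r s Y" for s Y
    unfolding is_transversal_def lightlike_def T
    by (simp add: lorentz_rotation110) (metis A0 rotation110_inverse)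
  have k: "k_g (?A \<circ> r) s = k_g r s" for s
  proof -
    have e: "\<exists>!Y. is_transversal r s Y" unfolding r_def by (rule transversal_ex1[OF assms(1)])
    then have Y: "is_transversal r s (transversal r s)"
      unfolding transversal_def by (rule theI')
    have "Z = ?A (transversal r s)" if "is_transversal (?A \<circ> r) s Z" for Z
    proof -
      have Z: "?A (rotation110 (- u) Z) = Z" using rotation110_inverse[of "- u"] by simp
      then have "is_transversal r s (rotation110 (- u) Z)" using that eq by metis
      then have "rotation110 (- u) Z = transversal r s" using e Y by auto
      then show ?thesis using Z by simp
    qed
    then have "transversal (?A \<circ> r) s = ?A (transversal r s)"
      unfolding transversal_def[of "?A \<circ> r"] using Y eq by (intro the_equality) auto
    then show ?thesis unfolding k_g_def N by (simp add: lorentz_rotation110)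
  qed
  show ?thesis
    unfolding flow_field_def ext[OF k] T
    by (simp add: linear_diff[OF linear_rotation110] linear_cmul[OF linear_rotation110])
qed

lemma rotation110_DERIV:
  "((\<lambda>t. rotation110 (c * t) v) has_vector_derivative
      c *\<^sub>R rotation110 (c * t) (killing110 v)) (at t)"
proof -
  have K3: "killing110 (killing110 (killing110 v)) = 0"
    by (simp add: killing110_def vec3)
  show ?thesis
    unfolding rotation110_def K3
    by (auto simp: has_vector_derivative_def algebra_simps power2_eq_square
        intro!: derivative_eq_intros)
qed

theorem rotates_around_110_iff:
  assumes "arclength_cone_curve \<psi> \<theta>"
  shows "rotates_around_110 (cone_curve \<psi> \<theta>) \<longleftrightarrow>
    (\<exists>c. c \<noteq> 0 \<and> moved_by (\<lambda>t. rotation110 (c * t)) (cone_curve \<psi> \<theta>))"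
proof -
  let ?r = "cone_curve \<psi> \<theta>"
  have id: "rotation110 0 = id" by (auto simp: rotation110_def)
  have "(\<forall>s. flow_field ?r s = c *\<^sub>R killing110 (?r s)) \<longleftrightarrow>
      moved_by (\<lambda>t. rotation110 (c * t)) ?r" for c
  proof
    assume J: "\<forall>s. flow_field ?r s = c *\<^sub>R killing110 (?r s)"
    then show "moved_by (\<lambda>t. rotation110 (c * t)) ?r"
      unfolding moved_by_def flow_field_rotation110[OF assms]
      using rotation110_DERIV
      by (simp add: id cone_isometry_rotation110 linear_cmul[OF linear_rotation110])
  next
    assume "moved_by (\<lambda>t. rotation110 (c * t)) ?r"
    then have "((\<lambda>t. rotation110 (c * t) (?r s)) has_vector_derivative flow_field ?r s) (at 0)" for s
    proof -
      have "((\<lambda>t. rotation110 (c * t) (?r s)) has_vector_derivative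
          flow_field (rotation110 (c * 0) \<circ> ?r) s) (at 0)"
        using \<open>moved_by _ _\<close> unfolding moved_by_def by blast
      then show ?thesis by (simp add: id)
    qed
    moreover have "((\<lambda>t. rotation110 (c * t) (?r s)) has_vector_derivative
        c *\<^sub>R killing110 (?r s)) (at 0)" for s
      using rotation110_DERIV[of c "?r s" 0] by (simp add: id)
    ultimately show "\<forall>s. flow_field ?r s = c *\<^sub>R killing110 (?r s)"
      using vector_derivative_unique_at by blast
  qed
  then show ?thesis unfolding rotates_around_110_def by simp
qed

end

theory Submission
  imports Defs
begin

text \<open>Let \<open>w = (1 - cos \<theta>) \<psi>\<close>, which is minus the Lorentz product of \<open>r\<close> with the axis
  \<open>(1,1,0)\<close>. Comparing components in the rotation condition gives \<open>k_g = c w\<close>. Since the axis is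
  light-like, its expansion in the frame \<open>r, T, Y\<close> yields \<open>w'\<^sup>2 = 2 w w'' - 2 k_g w\<^sup>2\<close>, hence
  \<open>k_g'\<^sup>2 = 2 k_g k_g'' - 2 k_g\<^sup>3\<close>, and the two integrated soliton equations turn this into
  \<open>\<mu> = 0\<close>. If \<open>c > 0\<close>, then \<open>k_g \<ge> 0\<close>; as \<open>k_g'\<close> vanishes at the extrema, the minimum would be
  \<open>0\<close> and the maximum \<open>sqrt \<lambda>\<close>, but in between \<open>k_g\<^sup>3 - \<lambda> k_g = k_g'\<^sup>2\<close> would be negative.\<close>

text \<open>Shifting by whole periods shows that every value of \<open>f\<close> is already taken on
  the compact interval \<open>{0..p}\<close>, so the extrema there are global.\<close>

lemma periodic_attains_extrema:
  fixes f :: "real \<Rightarrow> real"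
  assumes "continuous_on UNIV f" and "p > 0" and "\<And>s. f (s + p) = f s"
  obtains u v where "\<And>s. f u \<le> f s" "\<And>s. f s \<le> f v"
proof -
  have shift: "f (s + of_int n * p) = f s" for s and n :: int
  proof (induction n)
    case (nonneg n)
    then show ?case
    proof (induction n)
      case (Suc n)
      then show ?case using assms(3)[of "s + real n * p"] by (simp add: algebra_simps)
    qed simp
  next
    case (neg n)
    have "f (s - real m * p) = f s" for m
    proof (induction m)
      case (Suc m)
      then show ?case using assms(3)[of "s - real (Suc m) * p"] by (simp add: algebra_simps)
    qed simp
    from this[of "Suc n"] show ?case by (simp add: algebra_simps)
  qed
  have red: "\<exists>t\<in>{0..p}. f t = f s" for s
  proof
    have "of_int \<lfloor>s / p\<rfloor> * p \<le> s" "s < (of_int \<lfloor>s / p\<rfloor> + 1) * p"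
      using assms(2) floor_divide_lower floor_divide_upper by blast+
    then show "s + of_int (- \<lfloor>s / p\<rfloor>) * p \<in> {0..p}" by (simp add: algebra_simps)
  qed (rule shift)
  have c: "continuous_on {0..p} f" using assms(1) continuous_on_subset by blast
  obtain u where u: "\<And>t. t \<in> {0..p} \<Longrightarrow> f u \<le> f t"
    using continuous_attains_inf[OF compact_Icc _ c] assms(2) by fastforce
  obtain v where v: "\<And>t. t \<in> {0..p} \<Longrightarrow> f t \<le> f v"
    using continuous_attains_sup[OF compact_Icc _ c] assms(2) by fastforce
  show thesis using that u v red by metis
qed

text \<open>The cubic \<open>x ^ 3 - lam * x\<close> is a square, hence non-negative, on the range
  of \<open>f\<close>, and zero at the minimum and the maximum. Between two distinct non-negative
  roots it would be negative.\<close>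

lemma nonneg_periodic_constant:
  fixes f f' :: "real \<Rightarrow> real"
  assumes d: "\<And>s. (f has_real_derivative f' s) (at s)"
    and p: "p > 0" "\<And>s. f (s + p) = f s"
    and ode: "\<And>s. (f' s)\<^sup>2 = f s ^ 3 - lam * f s"
    and nn: "\<And>s. f s \<ge> 0"
  shows "f constant_on UNIV"
proof -
  have c: "continuous_on UNIV f"
    using d by (meson DERIV_isCont continuous_at_imp_continuous_on)
  obtain u v where u: "\<And>s. f u \<le> f s" and v: "\<And>s. f s \<le> f v"
    using periodic_attains_extrema[OF c p] by blast
  have "f' u = 0" by (rule DERIV_local_min[OF d, of 1]) (use u in auto)
  then have ru: "f u * ((f u)\<^sup>2 - lam) = 0"
    using ode[of u] by algebra
  have "f' v = 0" by (rule DERIV_local_max[OF d, of 1]) (use v in auto)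
  then have rv: "f v * ((f v)\<^sup>2 - lam) = 0"
    using ode[of v] by algebra
  have "f u = f v"
  proof (rule ccontr)
    assume "f u \<noteq> f v"
    then have lt: "f u < f v" using u[of v] by simp
    \<comment> \<open>Here \<open>f v > 0\<close>, so the maximum is the non-zero root; the smaller
      non-negative value \<open>f u\<close> can then only be the root 0.\<close>
    then have lam: "lam = (f v)\<^sup>2" using rv nn[of u] by simp
    have "(f u)\<^sup>2 < (f v)\<^sup>2" using lt nn[of u] by (simp add: power_strict_mono)
    then have fu: "f u = 0" using ru lam by simp
    \<comment> \<open>Any value strictly between the roots 0 and \<open>f v\<close> would do; at the
      midpoint the cubic equals \<open>(1/8 - 1/2) * f v ^ 3\<close>.\<close>
    have "f v / 2 \<in> range f"
    proof (rule connectedD_interval[of "range f" "f u" "f v"])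
      show "connected (range f)" using connected_continuous_image[OF c] by simp
    qed (use fu lt in auto)
    then obtain s where s: "f s = f v / 2" by (metis imageE)
    have "(f' s)\<^sup>2 = - 3 / 8 * f v ^ 3"
      unfolding ode s lam by (simp add: power2_eq_square power3_eq_cube field_simps)
    moreover have "f v ^ 3 > 0" using lt fu by simp
    ultimately show False using zero_le_power2[of "f' s"] by linarith
  qed
  then show ?thesis unfolding constant_on_def using u v by (metis order_antisym)
qed

lemma arclength_cone_curve_DERIV:
  assumes "arclength_cone_curve \<psi> \<theta>"
  shows "\<psi> s > 0"
    and "(\<psi> has_real_derivative deriv \<psi> s) (at s)"
    and "(deriv \<psi> has_real_derivative deriv (deriv \<psi>) s) (at s)"
    and "(\<theta> has_real_derivative 1 / \<psi> s) (at s)"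
proof -
  show "\<psi> s > 0" using assms by (simp add: arclength_cone_curve_def)
  show "(\<psi> has_real_derivative deriv \<psi> s) (at s)" "(\<theta> has_real_derivative 1 / \<psi> s) (at s)"
    using assms smooth_DERIV unfolding arclength_cone_curve_def by metis+
  have "(deriv ^^ 1) \<psi> differentiable at s"
    using assms unfolding arclength_cone_curve_def smooth_def by blast
  then show "(deriv \<psi> has_real_derivative deriv (deriv \<psi>) s) (at s)"
    by (simp add: DERIV_deriv_iff_real_differentiable)
qed

lemma tangent_cone_curve_eq:
  assumes "arclength_cone_curve \<psi> \<theta>"
  shows "tangent (cone_curve \<psi> \<theta>) s = vector [deriv \<psi> s,
     deriv \<psi> s * cos (\<theta> s) - sin (\<theta> s), deriv \<psi> s * sin (\<theta> s) + cos (\<theta> s)]"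
  unfolding tangent_def using vector_derivative_at[OF tangent_cone_curve[OF assms]] .

lemma vector_derivative_tangent_cone_curve:
  assumes "arclength_cone_curve \<psi> \<theta>"
  shows "vector_derivative (tangent (cone_curve \<psi> \<theta>)) (at s) = vector [deriv (deriv \<psi>) s,
     deriv (deriv \<psi>) s * cos (\<theta> s) - (deriv \<psi> s * sin (\<theta> s) + cos (\<theta> s)) / \<psi> s,
     deriv (deriv \<psi>) s * sin (\<theta> s) + (deriv \<psi> s * cos (\<theta> s) - sin (\<theta> s)) / \<psi> s]"
    (is "_ = ?D")
proof -
  note d = arclength_cone_curve_DERIV[OF assms]
  have "((\<lambda>s. tangent (cone_curve \<psi> \<theta>) s $ i) has_vector_derivative ?D $ i) (at s)" for i
    using exhaust_3[of i] d(1)[of s]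
    by (auto simp: tangent_cone_curve_eq[OF assms]
        has_real_derivative_iff_has_vector_derivative[symmetric] field_simps
        intro!: derivative_eq_intros d(2-4))
  then show ?thesis by (rule vector_derivative_at[OF has_vector_derivative_vec])
qed

text \<open>In coordinates turned by the angle \<open>\<theta> s\<close>, the transversality
  conditions determine the components of \<open>Y\<close>, and \<open>k_g\<close> is linear in them.
  The factor \<open>2 * (\<psi> s)\<^sup>2\<close> clears the denominators.\<close>

lemma k_g_cone_curve:
  assumes "arclength_cone_curve \<psi> \<theta>"
  shows "2 * (\<psi> s)\<^sup>2 * k_g (cone_curve \<psi> \<theta>) s
    = 2 * \<psi> s * deriv (deriv \<psi>) s - (deriv \<psi> s)\<^sup>2 - 1"
proof -
  define p q q' c z where "p = \<psi> s" and "q = deriv \<psi> s" and "q' = deriv (deriv \<psi>) s"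
    and "c = cos (\<theta> s)" and "z = sin (\<theta> s)"
  define Y where "Y = transversal (cone_curve \<psi> \<theta>) s"
  \<comment> \<open>Naming the inverse keeps all relations polynomial, as \<open>algebra\<close>
    requires.\<close>
  define i where "i = 1 / p"
  have p: "p > 0" using arclength_cone_curve_DERIV(1)[OF assms] by (simp add: p_def)
  then have i: "p * i = 1" by (simp add: i_def)
  have cz: "c\<^sup>2 + z\<^sup>2 = 1" by (simp add: c_def z_def)
  have "is_transversal (cone_curve \<psi> \<theta>) s Y"
    unfolding Y_def transversal_def by (rule theI'[OF transversal_ex1[OF assms]])
  then have h: "- Y$1 * Y$1 + Y$2 * Y$2 + Y$3 * Y$3 = 0"
     "- Y$1 * q + Y$2 * (q * c - z) + Y$3 * (q * z + c) = 0"
     "- p * Y$1 + p * c * Y$2 + p * z * Y$3 = 1"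
    by (simp_all add: is_transversal_def lightlike_def tangent_cone_curve_eq[OF assms]
        lorentz_def cone_curve_def p_def q_def c_def z_def)
  \<comment> \<open>The radial and angular components of \<open>(Y$2, Y$3)\<close> at the angle
    \<open>\<theta> s\<close>.\<close>
  define a b where "a = c * Y$2 + z * Y$3" and "b = c * Y$3 - z * Y$2"
  have 1: "p * (a - Y$1) = 1" using h(3) unfolding a_def by algebra
  have 2: "p * b = - q" using h(2) 1 unfolding a_def b_def by algebra
  have "a\<^sup>2 + b\<^sup>2 = (Y$1)\<^sup>2" using h(1) cz unfolding a_def b_def by algebra
  \<comment> \<open>Light-likeness factors as \<open>(a - Y$1) * (a + Y$1) = - b\<^sup>2\<close>,
    and the first factor is \<open>1 / p\<close>.\<close>
  then have 3: "p * (a + Y$1) = - q\<^sup>2" using 1 2 by algebra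
  have "k_g (cone_curve \<psi> \<theta>) s = - q' * Y$1 + (q' * c - (q * z + c) * i) * Y$2
      + (q' * z + (q * c - z) * i) * Y$3"
    by (simp add: k_g_def vector_derivative_tangent_cone_curve[OF assms] lorentz_def
        Y_def i_def p_def q_def q'_def c_def z_def)
  also have "\<dots> = q' * (a - Y$1) + q * b * i - a * i"
    by (simp add: a_def b_def algebra_simps)
  finally have "2 * p\<^sup>2 * k_g (cone_curve \<psi> \<theta>) s = 2 * p * q' - q\<^sup>2 - 1"
    using 1 2 3 i by algebra
  then show ?thesis by (simp add: p_def q_def q'_def)
qed

text \<open>The functions \<open>w\<close>, \<open>w'\<close>, \<open>w''\<close> are minus the
  Lorentz products of the axis with \<open>r\<close>, \<open>T\<close>, \<open>T'\<close>. The axis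
  is therefore \<open>(w'' - k_g w) r - w' T - w Y\<close>, and the last claim says that this vector
  has Lorentz square 0. The proof checks the identity in coordinates.\<close>

lemma axis_product:
  fixes \<psi> \<theta> :: "real \<Rightarrow> real"
  assumes "arclength_cone_curve \<psi> \<theta>"
  defines "w \<equiv> \<lambda>s. (1 - cos (\<theta> s)) * \<psi> s"
  obtains w' w'' where "\<And>s. (w has_real_derivative w' s) (at s)"
    and "\<And>s. (w' has_real_derivative w'' s) (at s)"
    and "\<And>s. (w' s)\<^sup>2 = 2 * w s * w'' s - 2 * k_g (cone_curve \<psi> \<theta>) s * (w s)\<^sup>2"
proof
  note d = arclength_cone_curve_DERIV[OF assms(1)]
  let ?w' = "\<lambda>s. deriv \<psi> s * (1 - cos (\<theta> s)) + sin (\<theta> s)"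
  let ?w'' = "\<lambda>s. deriv (deriv \<psi>) s * (1 - cos (\<theta> s))
    + (deriv \<psi> s * sin (\<theta> s) + cos (\<theta> s)) / \<psi> s"
  fix s
  show "(w has_real_derivative ?w' s) (at s)"
    unfolding w_def using d(1)[of s]
    by (auto simp: field_simps intro!: derivative_eq_intros d(2,4))
  show "(?w' has_real_derivative ?w'' s) (at s)"
    using d(1)[of s] by (auto simp: field_simps intro!: derivative_eq_intros d(2-4))
  define i where "i = 1 / \<psi> s"
  have i: "\<psi> s * i = 1" using d(1)[of s] by (simp add: i_def)
  have e: "?w'' s = deriv (deriv \<psi>) s * (1 - cos (\<theta> s))
    + (deriv \<psi> s * sin (\<theta> s) + cos (\<theta> s)) * i" by (simp add: i_def)
  show "(?w' s)\<^sup>2 = 2 * w s * ?w'' s - 2 * k_g (cone_curve \<psi> \<theta>) s * (w s)\<^sup>2"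
    unfolding e w_def using i k_g_cone_curve[OF assms(1), of s] sin_cos_squared_add[of "\<theta> s"]
    by algebra
qed

text \<open>Take the component along the angular unit vector
  \<open>(0, - sin \<theta>, cos \<theta>)\<close>: it is 0 for \<open>r\<close>, 1 for
  \<open>T\<close> and \<open>- (1 - cos \<theta>) \<psi>\<close> for the Killing field.\<close>

lemma k_g_rotates_around_110:
  assumes "arclength_cone_curve \<psi> \<theta>"
    and "flow_field (cone_curve \<psi> \<theta>) s = c *\<^sub>R killing110 (cone_curve \<psi> \<theta> s)"
  shows "k_g (cone_curve \<psi> \<theta>) s = c * ((1 - cos (\<theta> s)) * \<psi> s)"
proof -
  define r where "r = cone_curve \<psi> \<theta>"
  have "deriv (k_g r) s * \<psi> s - k_g r s * deriv \<psi> s = c * (\<psi> s * sin (\<theta> s))"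
    and "deriv (k_g r) s * (\<psi> s * cos (\<theta> s))
      - k_g r s * (deriv \<psi> s * cos (\<theta> s) - sin (\<theta> s)) = c * (\<psi> s * sin (\<theta> s))"
    and "deriv (k_g r) s * (\<psi> s * sin (\<theta> s))
      - k_g r s * (deriv \<psi> s * sin (\<theta> s) + cos (\<theta> s)) = c * (\<psi> s - \<psi> s * cos (\<theta> s))"
    using assms(2)
    by (simp_all add: flow_field_def tangent_cone_curve_eq[OF assms(1)] killing110_def vec3
        r_def cone_curve_def)
  then have "k_g r s = c * ((1 - cos (\<theta> s)) * \<psi> s)"
    using sin_cos_squared_add[of "\<theta> s"] by algebra
  then show ?thesis by (simp add: r_def)
qed

theorem proposition4p11:
  fixes \<psi> \<theta> :: "real \<Rightarrow> real" and lam mu :: real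
  assumes "arclength_cone_curve \<psi> \<theta>"
    and "space_periodic_soliton (cone_curve \<psi> \<theta>)"
    and "integration_constants (cone_curve \<psi> \<theta>) lam mu"
    and "rotates_around_110 (cone_curve \<psi> \<theta>)"
  shows "mu = 0 \<and>
    (\<exists>b>0. \<forall>s. (1 - cos (\<theta> s)) * \<psi> s = - b * k_g (cone_curve \<psi> \<theta>) s)"
proof -
  define k where "k = k_g (cone_curve \<psi> \<theta>)"
  define w where "w = (\<lambda>s. (1 - cos (\<theta> s)) * \<psi> s)"
  obtain c where c: "c \<noteq> 0" and kw: "\<And>s. k s = c * w s"
    using assms(4) k_g_rotates_around_110[OF assms(1)]
    unfolding rotates_around_110_def k_def w_def by blast
  obtain w' w'' where d1: "\<And>s. (w has_real_derivative w' s) (at s)"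
    and d2: "\<And>s. (w' has_real_derivative w'' s) (at s)"
    and id: "\<And>s. (w' s)\<^sup>2 = 2 * w s * w'' s - 2 * k s * (w s)\<^sup>2"
    using axis_product[OF assms(1)] unfolding w_def k_def by blast
  have k: "k = (\<lambda>s. c * w s)" using kw by auto
  have dk: "(k has_real_derivative c * w' s) (at s)" for s
    unfolding k by (rule DERIV_cmult[OF d1])
  have dk2: "((\<lambda>s. c * w' s) has_real_derivative c * w'' s) (at s)" for s
    by (rule DERIV_cmult[OF d2])
  have k1: "deriv k = (\<lambda>s. c * w' s)" using DERIV_imp_deriv[OF dk] by auto
  have k2: "deriv (deriv k) s = c * w'' s" for s
    unfolding k1 using DERIV_imp_deriv[OF dk2] .
  have ode2: "c * w'' s - 3 / 2 * (k s)\<^sup>2 + lam / 2 = 0"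
    and ode1: "(c * w' s)\<^sup>2 - k s ^ 3 + lam * k s + mu = 0" for s
    using assms(3) k1 k2 unfolding integration_constants_def k_def[symmetric] by auto
  have first: "(c * w' s)\<^sup>2 = k s ^ 3 - lam * k s" for s
  proof -
    \<comment> \<open>Scaling \<open>id\<close> by \<open>c\<^sup>2\<close> gives
      \<open>k'\<^sup>2 = k (2 k'') - 2 k\<^sup>3\<close>, into which this value of
      \<open>2 k''\<close> is substituted. Comparison with \<open>ode1\<close> then leaves
      \<open>mu = 0\<close>.\<close>
    have "2 * (c * w'' s) = 3 * (k s)\<^sup>2 - lam" using ode2[of s] by simp
    then show ?thesis using id[of s] kw[of s] by algebra
  qed
  then have mu: "mu = 0" using ode1[of 0] by simp
  have w: "w s \<ge> 0" for s
    using arclength_cone_curve_DERIV(1)[OF assms(1), of s] by (simp add: w_def)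
  obtain p where "p > 0" "\<And>s. k (s + p) = k s" and nc: "\<not> k constant_on UNIV"
    using assms(2) unfolding space_periodic_soliton_def k_def by blast
  then have "\<not> c > 0"
    using nonneg_periodic_constant[OF dk _ _ first] kw w by (metis less_imp_le mult_nonneg_nonneg)
  \<comment> \<open>Since \<open>k = c w\<close>, the constant \<open>b\<close> has to be
    \<open>- 1 / c\<close>, which is positive because \<open>c < 0\<close>.\<close>
  then have "- 1 / c > 0" using c by (simp add: divide_neg_neg)
  moreover have "w s = - (- 1 / c) * k s" for s using kw c by simp
  ultimately show ?thesis using mu unfolding w_def k_def by blast
qed

end
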